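(* Let $N$ be a positive integer, let $A^{(i)}\in\mathbb{R}^{I_i\times I_i}$ for $i=1,2,\ldots,N$, and let $\mathcal{A}=I-A^{(N)}\otimes\cdots\otimes A^{(2)}\otimes A^{(1)}$, where $I$ is the identity matrix of order $I_1I_2\cdots I_N$. For $i=1,\ldots,N$ let $y_i,z_i\in\mathbb{R}^{I_i}$ be vectors with $\|y_i\|_2=\|z_i\|_2=1$ and $$A^{(i)}(A^{(i)})^Ty_i=\sigma_{\max}^2(A^{(i)})\,y_i,\qquad A^{(i)}(A^{(i)})^Tz_i=\sigma_{\min}^2(A^{(i)})\,z_i.$$ Then $$\lambda_{\max}(\mathcal{A}\mathcal{A}^T)\ge 1+\prod_{i=1}^N\sigma_{\max}^2(A^{(i)})-2\prod_{i=1}^N y_i^T\mathcal{H}(A^{(i)})y_i$$ and $$\lambda_{\min}(\mathcal{A}\mathcal{A}^T)\le 1+\prod_{i=1}^N\sigma_{\min}^2(A^{(i)})-2\prod_{i=1}^N z_i^T\mathcal{H}(A^{(i)})z_i.$$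
   Context: $\otimes$ is the Kronecker product. For a real square matrix $A$, $\mathcal{H}(A)=\frac12(A+A^T)$ is its symmetric part, and $\sigma_{\max}(A)$, $\sigma_{\min}(A)$ are its largest and smallest singular values. For a square matrix with real eigenvalues, $\lambda_{\max}$ and $\lambda_{\min}$ denote its maximum and minimum eigenvalues. $\|\cdot\|_2$ on vectors is the Euclidean norm. *)

theory Defs
  imports
    "Jordan_Normal_Form.Spectral_Radius"
    "HOL-Analysis.L2_Norm"
begin

definition kronecker_mat :: "'a :: times mat \<Rightarrow> 'a mat \<Rightarrow> 'a mat" (infixr \<open>\<otimes>\<^sub>K\<close> 70)
  where "A \<otimes>\<^sub>K B =
    mat (dim_row A * dim_row B) (dim_col A * dim_col B)
      (\<lambda>(i, j). A $$ (i div dim_row B, j div dim_col B) * B $$ (i mod dim_row B, j mod dim_col B))"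

text \<open>
  The matrices are indexed from 1 and the highest index stands leftmost, so that
  \<open>kronecker_prod A N\<close> is \<open>A N \<otimes>\<^sub>K \<dots> \<otimes>\<^sub>K A 2 \<otimes>\<^sub>K A 1\<close>. The empty product is the identity of order 1,
  which is neutral for the Kronecker product.
\<close>

primrec kronecker_prod :: "(nat \<Rightarrow> 'a :: semiring_1 mat) \<Rightarrow> nat \<Rightarrow> 'a mat" where
  "kronecker_prod A 0 = 1\<^sub>m 1"
| "kronecker_prod A (Suc n) = A (Suc n) \<otimes>\<^sub>K kronecker_prod A n"

lemma kronecker_mat_one_right [simp]: "A \<otimes>\<^sub>K 1\<^sub>m 1 = (A :: 'a :: semiring_1 mat)"
  by (rule eq_matI) (auto simp: kronecker_mat_def)

lemma kronecker_prod_1: "kronecker_prod A 1 = A 1"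
  using kronecker_mat_one_right[of "A 1"] by simp

lemma kronecker_prod_carrier:
  assumes "\<And>i. i \<in> {1..n} \<Longrightarrow> A i \<in> carrier_mat (d i) (d i)"
  shows "kronecker_prod A n \<in> carrier_mat (\<Prod>i=1..n. d i) (\<Prod>i=1..n. d i)"
  using assms
proof (induction n)
  case (Suc n)
  have "A (Suc n) \<in> carrier_mat (d (Suc n)) (d (Suc n))"
    using Suc.prems by simp
  moreover have "kronecker_prod A n \<in> carrier_mat (\<Prod>i=1..n. d i) (\<Prod>i=1..n. d i)"
    using Suc by simp
  ultimately show ?case
    by (auto simp: kronecker_mat_def mult.commute)
qed simp

definition symmetric_part :: "real mat \<Rightarrow> real mat" where
  "symmetric_part A = (1 / 2) \<cdot>\<^sub>m (A + A\<^sup>T)"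

definition euclidean_norm :: "real vec \<Rightarrow> real" where
  "euclidean_norm v = L2_set (vec_index v) {..<dim_vec v}"

text \<open>
  The spectrum of a real matrix consists of its real eigenvalues only, so the next two constants
  are meant for square matrices of positive order all of whose eigenvalues are real (such as
  symmetric ones).
\<close>

definition lambda_max :: "real mat \<Rightarrow> real" where
  "lambda_max A = Max (spectrum A)"

definition lambda_min :: "real mat \<Rightarrow> real" where
  "lambda_min A = Min (spectrum A)"

text \<open>
  The matrix \<open>A\<^sup>T * A\<close> has as many eigenvalues as \<open>A\<close> has columns; for square \<open>A\<close> their square roots
  are exactly the singular values, with 0 included when \<open>A\<close> is singular.
\<close>

definition singular_values :: "real mat \<Rightarrow> real set" where
  "singular_values A = sqrt ` spectrum (A\<^sup>T * A)"

definition sigma_max :: "real mat \<Rightarrow> real" where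
  "sigma_max A = Max (singular_values A)"

definition sigma_min :: "real mat \<Rightarrow> real" where
  "sigma_min A = Min (singular_values A)"

end

theory Submission
  imports Defs
begin

text \<open>
  The Kronecker product \<open>Y\<close> of the \<open>y i\<close> is a unit vector. With \<open>T\<close> the Kronecker product of the
  \<open>A i\<close>, the Rayleigh quotient of \<open>AA * AA\<^sup>T\<close> at \<open>Y\<close> is the squared norm of \<open>Y - T\<^sup>T Y\<close>, and each of its
  three terms factorises over \<open>i\<close>; the same holds for the \<open>z i\<close>. That the spectrum of a real symmetric
  matrix \<open>S\<close> reaches below every Rayleigh quotient needs no compactness: let \<open>m\<close> be the best lower
  bound of the form of \<open>S\<close>. If \<open>S - m I\<close> were invertible, this positive semidefinite matrix would be
  coercive, and \<open>m\<close> could be increased.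
\<close>

section \<open>Bounds for quadratic forms of real matrices\<close>

lemma scalar_prod_self_nonneg: "0 \<le> x \<bullet> (x :: real vec)"
  by (simp add: scalar_prod_def sum_nonneg)

lemma smult_mat_mult_vec:
  fixes A :: "'a :: comm_semiring_0 mat"
  assumes A: "A \<in> carrier_mat m n" and v: "v \<in> carrier_vec n"
  shows "(k \<cdot>\<^sub>m A) *\<^sub>v v = k \<cdot>\<^sub>v (A *\<^sub>v v)"
proof (rule eq_vecI)
  fix i assume "i < dim_vec (k \<cdot>\<^sub>v (A *\<^sub>v v))"
  then have "i < m" using A by simp
  then show "((k \<cdot>\<^sub>m A) *\<^sub>v v) $ i = (k \<cdot>\<^sub>v (A *\<^sub>v v)) $ i"
    using A v by simp
qed (use A in simp)

text \<open>Every product of two coordinates of \<open>x\<close> is at most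
  \<open>x \<bullet> x\<close> in absolute value, so the sum of the absolute values of all entries
  bounds the form. Any constant will do for the later arguments.\<close>

lemma quadratic_form_bounded:
  fixes M :: "real mat"
  assumes M: "M \<in> carrier_mat n n"
  obtains K where "K > 0" "\<And>x. x \<in> carrier_vec n \<Longrightarrow> \<bar>x \<bullet> (M *\<^sub>v x)\<bar> \<le> K * (x \<bullet> x)"
proof -
  define K where "K = (\<Sum>i<n. \<Sum>j<n. \<bar>M $$ (i, j)\<bar>)"
  have K0: "K \<ge> 0" unfolding K_def by (intro sum_nonneg) auto
  have "\<bar>x \<bullet> (M *\<^sub>v x)\<bar> \<le> (K + 1) * (x \<bullet> x)" if x: "x \<in> carrier_vec n" for x
  proof -
    have xx: "x \<bullet> x = (\<Sum>i<n. x $ i * x $ i)"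
      using x by (simp add: scalar_prod_def atLeast0LessThan)
    have le: "x $ i * x $ i \<le> x \<bullet> x" if "i < n" for i
      unfolding xx using that by (intro member_le_sum) auto
    \<comment> \<open>From 2ab \<le> a^2 + b^2, with each square bounded by
      \<open>x \<bullet> x\<close> separately; this covers \<open>i = j\<close> as well.\<close>
    have prod_le: "\<bar>x $ i\<bar> * \<bar>x $ j\<bar> \<le> x \<bullet> x" if "i < n" "j < n" for i j
      using le[OF that(1)] le[OF that(2)] sum_squares_bound[of "\<bar>x $ i\<bar>" "\<bar>x $ j\<bar>"]
      by (simp add: power2_eq_square)
    have "x \<bullet> (M *\<^sub>v x) = (\<Sum>i<n. \<Sum>j<n. x $ i * (M $$ (i, j) * x $ j))"
      using x M by (simp add: scalar_prod_def atLeast0LessThan sum_distrib_left)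
    then have "\<bar>x \<bullet> (M *\<^sub>v x)\<bar> \<le> (\<Sum>i<n. \<Sum>j<n. \<bar>x $ i * (M $$ (i, j) * x $ j)\<bar>)"
      by (simp add: order.trans[OF sum_abs sum_mono[OF sum_abs]])
    also have "\<dots> \<le> (\<Sum>i<n. \<Sum>j<n. \<bar>M $$ (i, j)\<bar> * (x \<bullet> x))"
    proof (intro sum_mono)
      fix i j assume "i \<in> {..<n}" "j \<in> {..<n}"
      then have "\<bar>M $$ (i, j)\<bar> * (\<bar>x $ i\<bar> * \<bar>x $ j\<bar>) \<le> \<bar>M $$ (i, j)\<bar> * (x \<bullet> x)"
        by (intro mult_left_mono prod_le) auto
      then show "\<bar>x $ i * (M $$ (i, j) * x $ j)\<bar> \<le> \<bar>M $$ (i, j)\<bar> * (x \<bullet> x)"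
        by (simp add: abs_mult mult_ac)
    qed
    also have "\<dots> = K * (x \<bullet> x)" by (simp add: K_def sum_distrib_right)
    \<comment> \<open>Adding 1 makes the constant strictly positive even for a zero matrix, so that
      it can be divided by later.\<close>
    also have "\<dots> \<le> (K + 1) * (x \<bullet> x)"
      using scalar_prod_self_nonneg[of x] by (simp add: algebra_simps)
    finally show ?thesis .
  qed
  then show thesis using that[of "K + 1"] K0 by auto
qed

lemma symmetric_form_swap:
  fixes Q :: "real mat"
  assumes "Q \<in> carrier_mat n n" "Q\<^sup>T = Q" "x \<in> carrier_vec n" "w \<in> carrier_vec n"
  shows "x \<bullet> (Q *\<^sub>v w) = (Q *\<^sub>v x) \<bullet> w"
  using transpose_vec_mult_scalar[of Q n n w x] assms
  by metis

text \<open>Obtained by evaluating the form at \<open>x - t \<cdot>\<^sub>v (Q *\<^sub>v x)\<close> with \<open>t = 1 / K\<close>.\<close>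

lemma psd_norm_le_form:
  fixes Q :: "real mat"
  assumes Q: "Q \<in> carrier_mat n n" "Q\<^sup>T = Q"
    and psd: "\<And>x. x \<in> carrier_vec n \<Longrightarrow> 0 \<le> x \<bullet> (Q *\<^sub>v x)"
  obtains K where "K > 0"
    "\<And>x. x \<in> carrier_vec n \<Longrightarrow> (Q *\<^sub>v x) \<bullet> (Q *\<^sub>v x) \<le> K * (x \<bullet> (Q *\<^sub>v x))"
proof -
  obtain K where K: "K > 0"
    "\<And>x. x \<in> carrier_vec n \<Longrightarrow> \<bar>x \<bullet> (Q *\<^sub>v x)\<bar> \<le> K * (x \<bullet> x)"
    using quadratic_form_bounded[OF Q(1)] by blast
  have "(Q *\<^sub>v x) \<bullet> (Q *\<^sub>v x) \<le> K * (x \<bullet> (Q *\<^sub>v x))" if x: "x \<in> carrier_vec n" for x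
  proof -
    define w where "w = Q *\<^sub>v x"
    define t where "t = 1 / K"
    have w: "w \<in> carrier_vec n" using Q x by (simp add: w_def)
    note c = Q(1) x w mult_mat_vec_carrier[OF Q(1)]
    have "Q *\<^sub>v (x - t \<cdot>\<^sub>v w) = w - t \<cdot>\<^sub>v (Q *\<^sub>v w)"
      using c by (simp add: mult_minus_distrib_mat_vec mult_mat_vec w_def)
    then have "0 \<le> (x - t \<cdot>\<^sub>v w) \<bullet> (w - t \<cdot>\<^sub>v (Q *\<^sub>v w))"
      using psd[of "x - t \<cdot>\<^sub>v w"] c by simp
    also have "\<dots> = x \<bullet> w - t * (x \<bullet> (Q *\<^sub>v w)) - (t * (w \<bullet> w) - t * (t * (w \<bullet> (Q *\<^sub>v w))))"
      using c by (simp add: minus_scalar_prod_distrib[of _ n] scalar_prod_minus_distrib[of _ n] right_diff_distrib)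
    also have "x \<bullet> (Q *\<^sub>v w) = w \<bullet> w"
      using symmetric_form_swap[OF Q x w] by (simp add: w_def)
    finally have "2 * t * (w \<bullet> w) \<le> x \<bullet> w + t * (t * (w \<bullet> (Q *\<^sub>v w)))" by simp
    \<comment> \<open>Since \<open>t * K = 1\<close>, this bound turns the second-order term into
      \<open>t * (w \<bullet> w)\<close>, half of the left side; the other half survives.\<close>
    also have "\<dots> \<le> x \<bullet> w + t * (t * (K * (w \<bullet> w)))"
    proof -
      have "w \<bullet> (Q *\<^sub>v w) \<le> K * (w \<bullet> w)" "t \<ge> 0"
        using K(1) K(2)[OF w] by (auto simp: t_def)
      then show ?thesis by (intro add_left_mono mult_left_mono)
    qed
    also have "t * (t * (K * (w \<bullet> w))) = t * (w \<bullet> w)" using K(1) by (simp add: t_def)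
    finally have "t * (w \<bullet> w) \<le> x \<bullet> w" by simp
    then show ?thesis using K(1) by (simp add: t_def w_def[symmetric] field_simps)
  qed
  then show thesis using that K(1) by blast
qed

text \<open>With \<open>B\<close> inverse to \<open>Q\<close>, the vector \<open>x = B (Q x)\<close>
  has squared norm at most \<open>C\<close> times that of \<open>Q x\<close>, and the latter is at
  most \<open>K\<close> times the form at \<open>x\<close>. Hence
  \<open>e = 1 / (C * K)\<close>.\<close>

lemma psd_invertible_coercive:
  fixes Q :: "real mat"
  assumes Q: "Q \<in> carrier_mat n n" "Q\<^sup>T = Q"
    and psd: "\<And>x. x \<in> carrier_vec n \<Longrightarrow> 0 \<le> x \<bullet> (Q *\<^sub>v x)"
    and det: "det Q \<noteq> 0"
  obtains e where "e > 0" "\<And>x. x \<in> carrier_vec n \<Longrightarrow> e * (x \<bullet> x) \<le> x \<bullet> (Q *\<^sub>v x)"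
proof -
  \<comment> \<open>A nonzero determinant makes \<open>Q\<close> a unit of the matrix ring;
    \<open>()\<close> fills the extension slot of the ring record.\<close>
  obtain B where B: "B \<in> carrier_mat n n" "B * Q = 1\<^sub>m n"
    using det_non_zero_imp_unit[OF Q(1) det, of "()"]
    unfolding Units_def ring_mat_def by auto
  \<comment> \<open>The form of \<open>B\<^sup>T * B\<close> at \<open>w\<close> is the squared norm
    of \<open>B *\<^sub>v w\<close>, so bounding this form bounds the growth of norms under
    \<open>B\<close>.\<close>
  obtain C where C: "C > 0"
    "\<And>x. x \<in> carrier_vec n \<Longrightarrow> \<bar>x \<bullet> ((B\<^sup>T * B) *\<^sub>v x)\<bar> \<le> C * (x \<bullet> x)"
    using quadratic_form_bounded[of "B\<^sup>T * B" n] B(1) by (metis mult_carrier_mat transpose_carrier_mat)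
  obtain K where K: "K > 0"
    "\<And>x. x \<in> carrier_vec n \<Longrightarrow> (Q *\<^sub>v x) \<bullet> (Q *\<^sub>v x) \<le> K * (x \<bullet> (Q *\<^sub>v x))"
    using psd_norm_le_form[OF Q psd] by blast
  have "1 / (C * K) * (x \<bullet> x) \<le> x \<bullet> (Q *\<^sub>v x)" if x: "x \<in> carrier_vec n" for x
  proof -
    define w where "w = Q *\<^sub>v x"
    have w: "w \<in> carrier_vec n" using Q x by (simp add: w_def)
    have "B *\<^sub>v w = x"
      using B Q x by (metis w_def assoc_mult_mat_vec one_mult_mat_vec)
    then have "x \<bullet> x = w \<bullet> (B\<^sup>T *\<^sub>v (B *\<^sub>v w))"
      using transpose_vec_mult_scalar[OF B(1) w x] B(1) w x
      by (metis comm_scalar_prod mult_mat_vec_carrier transpose_carrier_mat)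
    also have "\<dots> = w \<bullet> ((B\<^sup>T * B) *\<^sub>v w)"
      using B(1) w by (subst assoc_mult_mat_vec[of _ n n _ n]) auto
    also have "\<dots> \<le> C * (w \<bullet> w)" using C(2)[OF w] by linarith
    also have "\<dots> \<le> C * (K * (x \<bullet> w))"
      using C(1) K(2)[OF x] by (simp add: w_def)
    finally show ?thesis using C(1) K(1) by (simp add: w_def field_simps)
  qed
  then show thesis using that[of "1 / (C * K)"] C(1) K(1) by simp
qed

section \<open>Extreme eigenvalues of real symmetric matrices\<close>

text \<open>A single eigenvalue below the whole form suffices, as the minimum of the spectrum lies
  below it in turn. The order must be positive: a matrix of order 0 has empty spectrum.\<close>

lemma symmetric_spectrum_le_form:
  fixes S :: "real mat"
  assumes S: "S \<in> carrier_mat n n" "S\<^sup>T = S" and n: "n > 0"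
  obtains k where "k \<in> spectrum S" "\<And>x. x \<in> carrier_vec n \<Longrightarrow> k * (x \<bullet> x) \<le> x \<bullet> (S *\<^sub>v x)"
proof -
  define L where "L = {c. \<forall>x \<in> carrier_vec n. c * (x \<bullet> x) \<le> x \<bullet> (S *\<^sub>v x)}"
  define m where "m = Sup L"
  obtain K where K: "\<And>x. x \<in> carrier_vec n \<Longrightarrow> \<bar>x \<bullet> (S *\<^sub>v x)\<bar> \<le> K * (x \<bullet> x)"
    using quadratic_form_bounded[OF S(1)] by blast
  have "- K * (x \<bullet> x) \<le> x \<bullet> (S *\<^sub>v x)" if "x \<in> carrier_vec n" for x
    using K[OF that] by (simp add: abs_le_iff)
  then have ne: "- K \<in> L" by (simp add: L_def)
  \<comment> \<open>The form at a single unit vector bounds \<open>L\<close>; such a vector exists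
    because \<open>n > 0\<close>.\<close>
  have bdd: "bdd_above L"
  proof (rule bdd_aboveI)
    fix c assume "c \<in> L"
    then show "c \<le> unit_vec n 0 \<bullet> (S *\<^sub>v unit_vec n 0)"
      using n unfolding L_def by (force dest: bspec[of _ _ "unit_vec n 0"])
  qed
  \<comment> \<open>The supremum is attained: for \<open>x \<bullet> x > 0\<close> every element of
    \<open>L\<close> is at most the Rayleigh quotient at \<open>x\<close>, hence so is
    \<open>m\<close>. If \<open>x \<bullet> x = 0\<close>, the factor is irrelevant and
    \<open>- K \<in> L\<close> gives the inequality.\<close>
  have m: "m * (x \<bullet> x) \<le> x \<bullet> (S *\<^sub>v x)" if x: "x \<in> carrier_vec n" for x
  proof (cases "x \<bullet> x = 0")
    case True
    then show ?thesis using ne x by (auto simp: L_def)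
  next
    case False
    then have pos: "x \<bullet> x > 0" using scalar_prod_self_nonneg[of x] by simp
    have "m \<le> (x \<bullet> (S *\<^sub>v x)) / (x \<bullet> x)"
      unfolding m_def
    proof (rule cSup_least)
      show "L \<noteq> {}" using ne by blast
    qed (use x pos in \<open>simp add: L_def pos_le_divide_eq\<close>)
    then show ?thesis using pos by (simp add: pos_le_divide_eq)
  qed
  define Q where "Q = S - m \<cdot>\<^sub>m 1\<^sub>m n"
  have Qv: "Q *\<^sub>v x = S *\<^sub>v x - m \<cdot>\<^sub>v x" if "x \<in> carrier_vec n" for x
    using S(1) that unfolding Q_def
    by (subst minus_mult_distrib_mat_vec[of _ n n]) (auto simp: smult_mat_mult_vec[of _ n n])
  have Qform: "x \<bullet> (Q *\<^sub>v x) = x \<bullet> (S *\<^sub>v x) - m * (x \<bullet> x)" if x: "x \<in> carrier_vec n" for x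
    using S(1) x by (simp add: Qv scalar_prod_minus_distrib[of _ n])
  have Q: "Q \<in> carrier_mat n n" unfolding Q_def by (intro minus_carrier_mat) simp
  have QT: "Q\<^sup>T = Q"
  proof (rule eq_matI)
    fix i j assume "i < dim_row Q" "j < dim_col Q"
    then have "i < n" "j < n" using Q by auto
    moreover from this have "S $$ (j, i) = S $$ (i, j)"
      using S by (metis carrier_matD index_transpose_mat(1))
    ultimately show "Q\<^sup>T $$ (i, j) = Q $$ (i, j)" using S(1) by (auto simp: Q_def)
  qed (use Q in auto)
  have "det Q = 0"
  proof (rule ccontr)
    assume "det Q \<noteq> 0"
    then obtain e where e: "e > 0" "\<And>x. x \<in> carrier_vec n \<Longrightarrow> e * (x \<bullet> x) \<le> x \<bullet> (Q *\<^sub>v x)"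
      using psd_invertible_coercive[OF Q QT] m Qform by (metis diff_ge_0_iff_ge)
    have "(m + e) * (x \<bullet> x) \<le> x \<bullet> (S *\<^sub>v x)" if "x \<in> carrier_vec n" for x
      using e(2)[OF that] Qform[OF that] by (simp add: algebra_simps)
    then have "m + e \<in> L" by (simp add: L_def)
    then have "m + e \<le> m" unfolding m_def using bdd by (rule cSup_upper)
    with e(1) show False by simp
  qed
  \<comment> \<open>A kernel vector of \<open>S - m I\<close> is an eigenvector of \<open>S\<close>
    for \<open>m\<close>.\<close>
  then obtain v where v: "v \<in> carrier_vec n" "v \<noteq> 0\<^sub>v n" "Q *\<^sub>v v = 0\<^sub>v n"
    using det_0_iff_vec_prod_zero_field[OF Q] by blast
  have "S *\<^sub>v v = m \<cdot>\<^sub>v v"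
  proof (rule eq_vecI)
    fix i assume "i < dim_vec (m \<cdot>\<^sub>v v)"
    then have i: "i < n" using v by simp
    have "(S *\<^sub>v v - m \<cdot>\<^sub>v v) $ i = 0" unfolding Qv[OF v(1), symmetric] v(3) using i by simp
    then show "(S *\<^sub>v v) $ i = (m \<cdot>\<^sub>v v) $ i" using i v S by simp
  qed (use S v in auto)
  then have "m \<in> spectrum S"
    using S v by (auto simp: spectrum_def eigenvalue_def eigenvector_def)
  then show thesis using that m by blast
qed

text \<open>Negation exchanges upper and lower bounds: an eigenvalue \<open>k\<close> of
  \<open>- S\<close> below its form yields the eigenvalue \<open>- k\<close> of
  \<open>S\<close>.\<close>

lemma symmetric_spectrum_ge_form:
  fixes S :: "real mat"
  assumes S: "S \<in> carrier_mat n n" "S\<^sup>T = S" and n: "n > 0"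
  obtains k where "k \<in> spectrum S" "\<And>x. x \<in> carrier_vec n \<Longrightarrow> x \<bullet> (S *\<^sub>v x) \<le> k * (x \<bullet> x)"
proof -
  obtain k where k: "k \<in> spectrum (- S)"
    "\<And>x. x \<in> carrier_vec n \<Longrightarrow> k * (x \<bullet> x) \<le> x \<bullet> (- S *\<^sub>v x)"
    using symmetric_spectrum_le_form[of "- S" n] S n by (auto simp: transpose_uminus)
  obtain v where v: "v \<in> carrier_vec n" "v \<noteq> 0\<^sub>v n" "- (S *\<^sub>v v) = k \<cdot>\<^sub>v v"
    using k(1) S by (auto simp: spectrum_def eigenvalue_def eigenvector_def)
  have "S *\<^sub>v v = (- k) \<cdot>\<^sub>v v"
  proof (rule eq_vecI)
    fix i assume "i < dim_vec ((- k) \<cdot>\<^sub>v v)"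
    then have i: "i < n" using v by simp
    have "(- (S *\<^sub>v v)) $ i = (k \<cdot>\<^sub>v v) $ i" by (simp only: v(3))
    then show "(S *\<^sub>v v) $ i = ((- k) \<cdot>\<^sub>v v) $ i"
      using i v(1) S(1) by (simp del: index_mult_mat_vec)
  qed (use S v in auto)
  then have "- k \<in> spectrum S"
    using v S by (auto simp: spectrum_def eigenvalue_def eigenvector_def)
  moreover have "x \<bullet> (S *\<^sub>v x) \<le> - k * (x \<bullet> x)" if x: "x \<in> carrier_vec n" for x
    using k(2)[OF x] S(1) x by simp
  ultimately show thesis using that by blast
qed

lemma lambda_bounds_form:
  fixes S :: "real mat"
  assumes S: "S \<in> carrier_mat n n" "S\<^sup>T = S" and x: "x \<in> carrier_vec n" "x \<bullet> x = 1"
  shows "lambda_min S \<le> x \<bullet> (S *\<^sub>v x)" and "x \<bullet> (S *\<^sub>v x) \<le> lambda_max S"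
proof -
  \<comment> \<open>In order 0 the scalar product is an empty sum and could not equal 1.\<close>
  have n: "n > 0" using x by (cases n) (auto simp: scalar_prod_def)
  \<comment> \<open>Finiteness lets \<open>Min\<close> and \<open>Max\<close> be compared with the
    eigenvalues found below.\<close>
  have fin: "finite (spectrum S)" by (rule card_finite_spectrum(1)[OF S(1)])
  obtain k where "k \<in> spectrum S" "k * (x \<bullet> x) \<le> x \<bullet> (S *\<^sub>v x)"
    using symmetric_spectrum_le_form[OF S n] x by metis
  then show "lambda_min S \<le> x \<bullet> (S *\<^sub>v x)"
    using x(2) Min_le[OF fin, of k] by (simp add: lambda_min_def)
  obtain k where "k \<in> spectrum S" "x \<bullet> (S *\<^sub>v x) \<le> k * (x \<bullet> x)"
    using symmetric_spectrum_ge_form[OF S n] x by metis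
  then show "x \<bullet> (S *\<^sub>v x) \<le> lambda_max S"
    using x(2) Max_ge[OF fin, of k] by (simp add: lambda_max_def)
qed

section \<open>Kronecker products of vectors\<close>

text \<open>Indices split by \<open>div\<close> and \<open>mod\<close> exactly as in
  \<open>kronecker_mat\<close>, the right factor running fastest, so that matrix and vector products
  are compatible.\<close>

definition kronecker_vec :: "'a :: times vec \<Rightarrow> 'a vec \<Rightarrow> 'a vec" (infixr \<open>\<otimes>\<^sub>V\<close> 70)
  where "u \<otimes>\<^sub>V v = vec (dim_vec u * dim_vec v) (\<lambda>i. u $ (i div dim_vec v) * v $ (i mod dim_vec v))"

primrec kronecker_vec_prod :: "(nat \<Rightarrow> 'a :: semiring_1 vec) \<Rightarrow> nat \<Rightarrow> 'a vec" where
  "kronecker_vec_prod y 0 = vec 1 (\<lambda>_. 1)"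
| "kronecker_vec_prod y (Suc n) = y (Suc n) \<otimes>\<^sub>V kronecker_vec_prod y n"

lemma kronecker_vec_carrier:
  "u \<in> carrier_vec m \<Longrightarrow> v \<in> carrier_vec n \<Longrightarrow> u \<otimes>\<^sub>V v \<in> carrier_vec (m * n)"
  by (rule carrier_vecI) (simp add: kronecker_vec_def)

text \<open>Cut the range into \<open>m\<close> blocks of length \<open>n\<close>: on the block
  starting at \<open>k * n\<close> the quotient is constantly \<open>k\<close> and the remainder
  runs through all \<open>j < n\<close>.\<close>

lemma sum_div_mod_eq_prod:
  fixes f g :: "nat \<Rightarrow> 'a :: semiring_0"
  shows "(\<Sum>i<m * n. f (i div n) * g (i mod n)) = (\<Sum>i<m. f i) * (\<Sum>j<n. g j)"
proof -
  have "(\<Sum>i<m * n. f (i div n) * g (i mod n))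
      = (\<Sum>k<m. \<Sum>i\<in>{k * n..<k * n + n}. f (i div n) * g (i mod n))"
    by (rule sum.nat_group[symmetric])
  also have "\<dots> = (\<Sum>k<m. \<Sum>j<n. f k * g j)"
  proof (rule sum.cong[OF refl])
    fix k
    \<comment> \<open>The bounds are spelled this way to match the rule that shifts the block back
      to start at 0.\<close>
    have "(\<Sum>i\<in>{0 + k * n..<n + k * n}. f (i div n) * g (i mod n))
        = (\<Sum>i\<in>{0..<n}. f ((i + k * n) div n) * g ((i + k * n) mod n))"
      by (rule sum.shift_bounds_nat_ivl)
    also have "\<dots> = (\<Sum>j<n. f k * g j)" by (rule sum.cong) auto
    finally show "(\<Sum>i\<in>{k * n..<k * n + n}. f (i div n) * g (i mod n)) = (\<Sum>j<n. f k * g j)"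
      by (simp add: add.commute)
  qed
  also have "\<dots> = (\<Sum>i<m. f i) * (\<Sum>j<n. g j)" by (simp add: sum_product)
  finally show ?thesis .
qed

text \<open>By commutativity each summand is a function of the quotient times a function of the
  remainder, so the double sum factorises.\<close>

lemma kronecker_scalar_prod:
  fixes u u' v v' :: "'a :: comm_semiring_0 vec"
  assumes "u \<in> carrier_vec m" "u' \<in> carrier_vec m" "v \<in> carrier_vec n" "v' \<in> carrier_vec n"
  shows "(u \<otimes>\<^sub>V v) \<bullet> (u' \<otimes>\<^sub>V v') = (u \<bullet> u') * (v \<bullet> v')"
proof -
  have "(u \<otimes>\<^sub>V v) \<bullet> (u' \<otimes>\<^sub>V v')
      = (\<Sum>i<m * n. (u $ (i div n) * u' $ (i div n)) * (v $ (i mod n) * v' $ (i mod n)))"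
    using assms by (auto simp: kronecker_vec_def scalar_prod_def atLeast0LessThan mult_ac intro!: sum.cong)
  then show ?thesis
    using assms sum_div_mod_eq_prod[of "\<lambda>i. u $ i * u' $ i" n "\<lambda>j. v $ j * v' $ j" m]
    by (simp add: scalar_prod_def atLeast0LessThan)
qed

lemma div_mod_less_mult:
  fixes i m n :: nat
  assumes "i < m * n"
  shows "i div n < m" "i mod n < n"
proof -
  have "n > 0" using assms by (cases n) auto
  then show "i mod n < n" by simp
  show "i div n < m" using assms by (simp add: less_mult_imp_div_less)
qed

text \<open>Each row of \<open>A \<otimes>\<^sub>K B\<close> is the Kronecker product of a row of
  \<open>A\<close> and a row of \<open>B\<close>, which reduces every entry to
  \<open>kronecker_scalar_prod\<close>.\<close>

lemma kronecker_mat_mult_vec: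
  fixes A B :: "'a :: comm_semiring_0 mat"
  assumes "A \<in> carrier_mat m k" "B \<in> carrier_mat n l" "u \<in> carrier_vec k" "v \<in> carrier_vec l"
  shows "(A \<otimes>\<^sub>K B) *\<^sub>v (u \<otimes>\<^sub>V v) = (A *\<^sub>v u) \<otimes>\<^sub>V (B *\<^sub>v v)"
proof (rule eq_vecI)
  fix i assume "i < dim_vec ((A *\<^sub>v u) \<otimes>\<^sub>V (B *\<^sub>v v))"
  then have i: "i < m * n" using assms by (simp add: kronecker_vec_def)
  note di = div_mod_less_mult[OF i]
  have "row (A \<otimes>\<^sub>K B) i = row A (i div n) \<otimes>\<^sub>V row B (i mod n)"
    using assms i di by (intro eq_vecI)
      (auto simp: kronecker_mat_def kronecker_vec_def div_mod_less_mult)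
  then show "((A \<otimes>\<^sub>K B) *\<^sub>v (u \<otimes>\<^sub>V v)) $ i = ((A *\<^sub>v u) \<otimes>\<^sub>V (B *\<^sub>v v)) $ i"
    using assms i di kronecker_scalar_prod[of "row A (i div n)" k u "row B (i mod n)" l v]
    by (simp add: kronecker_vec_def kronecker_mat_def)
qed (use assms in \<open>auto simp: kronecker_mat_def kronecker_vec_def\<close>)

lemma kronecker_mat_transpose: "(A \<otimes>\<^sub>K B)\<^sup>T = A\<^sup>T \<otimes>\<^sub>K B\<^sup>T"
proof (rule eq_matI)
  fix i j assume "i < dim_row (A\<^sup>T \<otimes>\<^sub>K B\<^sup>T)" "j < dim_col (A\<^sup>T \<otimes>\<^sub>K B\<^sup>T)"
  then have "i < dim_col A * dim_col B" "j < dim_row A * dim_row B"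
    by (simp_all add: kronecker_mat_def)
  note this div_mod_less_mult[OF this(1)] div_mod_less_mult[OF this(2)]
  then show "(A \<otimes>\<^sub>K B)\<^sup>T $$ (i, j) = (A\<^sup>T \<otimes>\<^sub>K B\<^sup>T) $$ (i, j)"
    by (simp add: kronecker_mat_def)
qed (simp_all add: kronecker_mat_def)

lemma kronecker_prod_transpose: "(kronecker_prod A n)\<^sup>T = kronecker_prod (\<lambda>i. (A i)\<^sup>T) n"
  by (induction n) (simp_all add: kronecker_mat_transpose)

lemma kronecker_vec_prod_carrier:
  assumes "\<And>i. i \<in> {1..n} \<Longrightarrow> y i \<in> carrier_vec (d i)"
  shows "kronecker_vec_prod y n \<in> carrier_vec (\<Prod>i=1..n. d i)"
  using assms
proof (induction n)
  case (Suc n)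
  then show ?case
    using kronecker_vec_carrier[of "y (Suc n)" "d (Suc n)" "kronecker_vec_prod y n" "\<Prod>i=1..n. d i"]
    by (simp add: mult.commute)
qed simp

lemma kronecker_prod_mult_vec_prod:
  fixes A :: "nat \<Rightarrow> 'a :: comm_semiring_1 mat"
  assumes "\<And>i. i \<in> {1..n} \<Longrightarrow> A i \<in> carrier_mat (d i) (d i)"
    and "\<And>i. i \<in> {1..n} \<Longrightarrow> y i \<in> carrier_vec (d i)"
  shows "kronecker_prod A n *\<^sub>v kronecker_vec_prod y n = kronecker_vec_prod (\<lambda>i. A i *\<^sub>v y i) n"
  using assms
proof (induction n)
  case (Suc n)
  then show ?case
    using kronecker_mat_mult_vec[of "A (Suc n)" "d (Suc n)" "d (Suc n)" "kronecker_prod A n"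
        "\<Prod>i=1..n. d i" "\<Prod>i=1..n. d i" "y (Suc n)" "kronecker_vec_prod y n"]
      kronecker_prod_carrier[of n A d] kronecker_vec_prod_carrier[of n y d] by simp
qed simp

text \<open>Iterates the two-factor rule; all three terms of the expanded Rayleigh quotient
  factorise through this.\<close>

lemma kronecker_vec_prod_scalar_prod:
  fixes y z :: "nat \<Rightarrow> 'a :: comm_semiring_1 vec"
  assumes "\<And>i. i \<in> {1..n} \<Longrightarrow> y i \<in> carrier_vec (d i)"
    and "\<And>i. i \<in> {1..n} \<Longrightarrow> z i \<in> carrier_vec (d i)"
  shows "kronecker_vec_prod y n \<bullet> kronecker_vec_prod z n = (\<Prod>i=1..n. y i \<bullet> z i)"
  using assms
proof (induction n)
  case (Suc n)
  then show ?case
    using kronecker_scalar_prod[of "y (Suc n)" "d (Suc n)" "z (Suc n)" "kronecker_vec_prod y n"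
        "\<Prod>i=1..n. d i" "kronecker_vec_prod z n"]
      kronecker_vec_prod_carrier[of n y d] kronecker_vec_prod_carrier[of n z d]
    by (simp add: mult.commute)
qed (simp add: scalar_prod_def)

section \<open>The Rayleigh quotient at the Kronecker test vector\<close>

lemma euclidean_norm_eq_1D: "euclidean_norm v = 1 \<Longrightarrow> v \<bullet> v = 1"
  by (simp add: euclidean_norm_def L2_set_def scalar_prod_def atLeast0LessThan power2_eq_square)

text \<open>A matrix and its transpose have the same quadratic form, hence so does their
  average.\<close>

lemma symmetric_part_form:
  assumes A: "A \<in> carrier_mat n n" and x: "x \<in> carrier_vec n"
  shows "x \<bullet> (symmetric_part A *\<^sub>v x) = x \<bullet> (A *\<^sub>v x)"
proof -
  have "(A\<^sup>T *\<^sub>v x) \<bullet> x = x \<bullet> (A *\<^sub>v x)"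
    by (rule transpose_vec_mult_scalar[OF A x x])
  then have "x \<bullet> (A\<^sup>T *\<^sub>v x) = x \<bullet> (A *\<^sub>v x)"
    using A x by (metis comm_scalar_prod mult_mat_vec_carrier transpose_carrier_mat)
  then have "x \<bullet> ((A + A\<^sup>T) *\<^sub>v x) = 2 * (x \<bullet> (A *\<^sub>v x))"
    using A x by (simp add: add_mult_distrib_mat_vec[of _ n n] scalar_prod_add_distrib[of _ n])
  moreover have "symmetric_part A *\<^sub>v x = (1 / 2) \<cdot>\<^sub>v ((A + A\<^sup>T) *\<^sub>v x)"
    unfolding symmetric_part_def using A x by (intro smult_mat_mult_vec[of _ n n]) auto
  ultimately show ?thesis using A x by simp
qed

lemma mult_transpose_form:
  fixes A :: "'a :: comm_semiring_0 mat"
  assumes A: "A \<in> carrier_mat n n" and x: "x \<in> carrier_vec n"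
  shows "x \<bullet> ((A * A\<^sup>T) *\<^sub>v x) = (A\<^sup>T *\<^sub>v x) \<bullet> (A\<^sup>T *\<^sub>v x)"
proof -
  have AT: "A\<^sup>T \<in> carrier_mat n n" using A by simp
  have "(A\<^sup>T *\<^sub>v x) \<bullet> (A\<^sup>T *\<^sub>v x) = x \<bullet> (A *\<^sub>v (A\<^sup>T *\<^sub>v x))"
    by (rule transpose_vec_mult_scalar[OF A mult_mat_vec_carrier[OF AT x] x])
  then show ?thesis by (simp only: assoc_mult_mat_vec[OF A AT x])
qed

text \<open>The eigenvalues \<open>s i\<close> are left arbitrary so that one computation serves
  both the largest and the smallest singular values.\<close>

lemma kronecker_test_vector_form:
  fixes A :: "nat \<Rightarrow> real mat" and y :: "nat \<Rightarrow> real vec"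
  assumes A: "\<And>i. i \<in> {1..N} \<Longrightarrow> A i \<in> carrier_mat (d i) (d i)"
    and y: "\<And>i. i \<in> {1..N} \<Longrightarrow> y i \<in> carrier_vec (d i)"
    and norm: "\<And>i. i \<in> {1..N} \<Longrightarrow> y i \<bullet> y i = 1"
    and eig: "\<And>i. i \<in> {1..N} \<Longrightarrow> (A i * (A i)\<^sup>T) *\<^sub>v y i = s i \<cdot>\<^sub>v y i"
    and M: "M = 1\<^sub>m (\<Prod>i=1..N. d i) - kronecker_prod A N"
  shows "kronecker_vec_prod y N \<bullet> ((M * M\<^sup>T) *\<^sub>v kronecker_vec_prod y N) =
    1 + (\<Prod>i=1..N. s i) - 2 * (\<Prod>i=1..N. y i \<bullet> (symmetric_part (A i) *\<^sub>v y i))"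
proof -
  define D where "D = (\<Prod>i=1..N. d i)"
  define Y where "Y = kronecker_vec_prod y N"
  define T where "T = kronecker_prod A N"
  have T: "T \<in> carrier_mat D D" "T\<^sup>T \<in> carrier_mat D D"
    using kronecker_prod_carrier[of N A d] A by (auto simp: T_def D_def)
  have Y: "Y \<in> carrier_vec D" using kronecker_vec_prod_carrier[of N y d] y by (simp add: Y_def D_def)
  have TY: "T\<^sup>T *\<^sub>v Y \<in> carrier_vec D" using T Y by simp
  have Mc: "M \<in> carrier_mat D D"
    unfolding M using T(1) unfolding T_def D_def by (rule minus_carrier_mat)
  \<comment> \<open>Transposition passes to the factors, so \<open>T\<^sup>T\<close> acts on
    \<open>Y\<close> factor by factor.\<close>
  have TY_eq: "T\<^sup>T *\<^sub>v Y = kronecker_vec_prod (\<lambda>i. (A i)\<^sup>T *\<^sub>v y i) N"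
    unfolding T_def Y_def kronecker_prod_transpose
    using A y by (intro kronecker_prod_mult_vec_prod) auto
  have YY: "Y \<bullet> Y = 1"
    unfolding Y_def using y norm by (subst kronecker_vec_prod_scalar_prod[where d = d]) auto
  have TYTY: "(T\<^sup>T *\<^sub>v Y) \<bullet> (T\<^sup>T *\<^sub>v Y) = (\<Prod>i=1..N. s i)"
  proof -
    \<comment> \<open>The squared norm is the form of \<open>A i * (A i)\<^sup>T\<close> at a unit
      eigenvector, hence the eigenvalue.\<close>
    have "((A i)\<^sup>T *\<^sub>v y i) \<bullet> ((A i)\<^sup>T *\<^sub>v y i) = s i" if "i \<in> {1..N}" for i
      using mult_transpose_form[OF A[OF that] y[OF that]] eig[OF that] norm[OF that] by simp
    then show ?thesis
      unfolding TY_eq using A y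
      by (subst kronecker_vec_prod_scalar_prod[where d = d])
        (auto intro!: mult_mat_vec_carrier prod.cong)
  qed
  have TYY: "(T\<^sup>T *\<^sub>v Y) \<bullet> Y = (\<Prod>i=1..N. y i \<bullet> (symmetric_part (A i) *\<^sub>v y i))"
  proof -
    have "((A i)\<^sup>T *\<^sub>v y i) \<bullet> y i = y i \<bullet> (symmetric_part (A i) *\<^sub>v y i)" if "i \<in> {1..N}" for i
      using transpose_vec_mult_scalar[OF A[OF that] y[OF that] y[OF that]]
        symmetric_part_form[OF A[OF that] y[OF that]] by simp
    then show ?thesis
      unfolding TY_eq unfolding Y_def using A y
      by (subst kronecker_vec_prod_scalar_prod[where d = d])
        (auto intro!: mult_mat_vec_carrier prod.cong)
  qed
  have "M\<^sup>T *\<^sub>v Y = Y - T\<^sup>T *\<^sub>v Y"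
    unfolding M T_def[symmetric] D_def[symmetric] using T Y
    by (simp add: transpose_minus[of _ D D] minus_mult_distrib_mat_vec[of _ D D])
  then have "Y \<bullet> ((M * M\<^sup>T) *\<^sub>v Y) = (Y - T\<^sup>T *\<^sub>v Y) \<bullet> (Y - T\<^sup>T *\<^sub>v Y)"
    using mult_transpose_form[OF Mc Y] by simp
  \<comment> \<open>The two cross terms coincide by symmetry of the scalar product, which produces
    the factor 2.\<close>
  also have "\<dots> = 1 - (T\<^sup>T *\<^sub>v Y) \<bullet> Y - ((T\<^sup>T *\<^sub>v Y) \<bullet> Y - (T\<^sup>T *\<^sub>v Y) \<bullet> (T\<^sup>T *\<^sub>v Y))"
    using Y TY YY comm_scalar_prod[OF Y TY]
    by (simp add: minus_scalar_prod_distrib[of _ D] scalar_prod_minus_distrib[of _ D])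
  finally show ?thesis using TYTY TYY by (simp add: Y_def)
qed

theorem proposition2p3:
  fixes N :: nat
    and d :: "nat \<Rightarrow> nat"
    and A :: "nat \<Rightarrow> real mat"
    and AA :: "real mat"
    and y z :: "nat \<Rightarrow> real vec"
  assumes "N > 0"
    and "\<And>i. i \<in> {1..N} \<Longrightarrow> A i \<in> carrier_mat (d i) (d i)"
    and "AA = 1\<^sub>m (\<Prod>i=1..N. d i) - kronecker_prod A N"
    and "\<And>i. i \<in> {1..N} \<Longrightarrow> y i \<in> carrier_vec (d i)"
    and "\<And>i. i \<in> {1..N} \<Longrightarrow> z i \<in> carrier_vec (d i)"
    and "\<And>i. i \<in> {1..N} \<Longrightarrow> euclidean_norm (y i) = 1"
    and "\<And>i. i \<in> {1..N} \<Longrightarrow> euclidean_norm (z i) = 1"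
    and "\<And>i. i \<in> {1..N} \<Longrightarrow> (A i * (A i)\<^sup>T) *\<^sub>v y i = (sigma_max (A i))\<^sup>2 \<cdot>\<^sub>v y i"
    and "\<And>i. i \<in> {1..N} \<Longrightarrow> (A i * (A i)\<^sup>T) *\<^sub>v z i = (sigma_min (A i))\<^sup>2 \<cdot>\<^sub>v z i"
  shows "lambda_max (AA * AA\<^sup>T) \<ge>
           1 + (\<Prod>i=1..N. (sigma_max (A i))\<^sup>2)
             - 2 * (\<Prod>i=1..N. y i \<bullet> (symmetric_part (A i) *\<^sub>v y i))
       \<and> lambda_min (AA * AA\<^sup>T) \<le>
           1 + (\<Prod>i=1..N. (sigma_min (A i))\<^sup>2)
             - 2 * (\<Prod>i=1..N. z i \<bullet> (symmetric_part (A i) *\<^sub>v z i))"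
proof -
  define D where "D = (\<Prod>i=1..N. d i)"
  have "kronecker_prod A N \<in> carrier_mat D D"
    unfolding D_def using assms(2) by (rule kronecker_prod_carrier)
  then have AA: "AA \<in> carrier_mat D D"
    unfolding assms(3) D_def by (rule minus_carrier_mat)
  have S: "AA * AA\<^sup>T \<in> carrier_mat D D" using AA by simp
  have ST: "(AA * AA\<^sup>T)\<^sup>T = AA * AA\<^sup>T" using AA by (simp add: transpose_mult[of _ D D _ D])
  have unit: "kronecker_vec_prod w N \<in> carrier_vec D" "kronecker_vec_prod w N \<bullet> kronecker_vec_prod w N = 1"
    if "\<And>i. i \<in> {1..N} \<Longrightarrow> w i \<in> carrier_vec (d i)" "\<And>i. i \<in> {1..N} \<Longrightarrow> euclidean_norm (w i) = 1" for w
    using that kronecker_vec_prod_carrier[of N w d] kronecker_vec_prod_scalar_prod[of N w d w]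
    by (auto simp: D_def euclidean_norm_eq_1D)
  \<comment> \<open>Here \<open>s i\<close> is the square of \<open>sigma_max (A i)\<close>; the
    bound is thus a value of the form at a unit vector.\<close>
  have "1 + (\<Prod>i=1..N. (sigma_max (A i))\<^sup>2) - 2 * (\<Prod>i=1..N. y i \<bullet> (symmetric_part (A i) *\<^sub>v y i))
      = kronecker_vec_prod y N \<bullet> ((AA * AA\<^sup>T) *\<^sub>v kronecker_vec_prod y N)"
    by (rule kronecker_test_vector_form[symmetric, OF assms(2) assms(4) euclidean_norm_eq_1D[OF assms(6)] assms(8) assms(3)])
  also have "\<dots> \<le> lambda_max (AA * AA\<^sup>T)"
    by (rule lambda_bounds_form(2)[OF S ST unit[OF assms(4) assms(6)]])
  finally have max: "1 + (\<Prod>i=1..N. (sigma_max (A i))\<^sup>2)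
      - 2 * (\<Prod>i=1..N. y i \<bullet> (symmetric_part (A i) *\<^sub>v y i)) \<le> lambda_max (AA * AA\<^sup>T)" .
  have "lambda_min (AA * AA\<^sup>T)
      \<le> kronecker_vec_prod z N \<bullet> ((AA * AA\<^sup>T) *\<^sub>v kronecker_vec_prod z N)"
    by (rule lambda_bounds_form(1)[OF S ST unit[OF assms(5) assms(7)]])
  also have "\<dots> = 1 + (\<Prod>i=1..N. (sigma_min (A i))\<^sup>2)
      - 2 * (\<Prod>i=1..N. z i \<bullet> (symmetric_part (A i) *\<^sub>v z i))"
    by (rule kronecker_test_vector_form[OF assms(2) assms(5) euclidean_norm_eq_1D[OF assms(7)] assms(9) assms(3)])
  finally show ?thesis using max by simp
qed

end
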